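(* Let $r,n\ge 1$ be integers and let $G$ be an $r$-regular multigraph on $n$ vertices with no self-loops (multiple edges allowed). Then $G$ has a $\lceil \frac{n}{3}\rceil$-match. Equality holds (that is, the maximum number of edges in a match of $G$ equals $\lceil \frac{n}{3}\rceil$) if $r=2l$ and $n=3q$ for some integers $l,q\ge 1$, and $G$ is a disjoint union of $q$ $2l$-regular multigraphs, each on three vertices and without self-loops. In particular, for all integers $n\ge 1$ and $r\ge 1$, $\theta(k,n,r)>0$ for every $k\in\{1,2,\ldots,\lceil \frac{2n}{3}\rceil\}$.
   Context: Graphs are finite, undirected, without self-loops, but possibly with multiple edges; the degree of a vertex counts edges with multiplicity, and a multigraph is $r$-regular if every vertex has degree $r$. A match in $G=(V,E)$ is a subset $M\subset E$ of edges such that no two edges in $M$ have a common vertex; $M$ is a $k$-match if it has exactly $k$ edges. $\phi(k,G)$ denotes the number of $k$-matches in $G$ (with parallel edges regarded as distinct edges). $\mathcal{G}_{mult}(2n,r)$ denotes the set of $r$-regular graphs on $2n$ vertices, where multiple edges are allowed (no self-loops), and $\theta(k,n,r):=\min\{\phi(k,G) : G\in\mathcal{G}_{mult}(2n,r)\}$. Note that in $\theta(k,n,r)$ the graphs have $2n$ vertices. *)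

theory Defs
  imports Complex_Main
begin

text \<open>
  Edges are objects of their own, mapped by \<open>ends\<close> to their set of end vertices; parallel edges
  are distinct edges with the same ends. The values of \<open>ends\<close> outside \<open>edges\<close> are irrelevant.
\<close>

record ('v, 'e) multigraph =
  verts :: "'v set"
  edges :: "'e set"
  ends :: "'e \<Rightarrow> 'v set"

text \<open>Requiring exactly two ends excludes self-loops.\<close>

definition loopless_multigraph :: "('v, 'e) multigraph \<Rightarrow> bool" where
  "loopless_multigraph G \<longleftrightarrow>
     finite (verts G) \<and> finite (edges G) \<and>
     (\<forall>e\<in>edges G. ends G e \<subseteq> verts G \<and> card (ends G e) = 2)"

definition degree :: "('v, 'e) multigraph \<Rightarrow> 'v \<Rightarrow> nat" where
  "degree G v = card {e \<in> edges G. v \<in> ends G e}"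

definition regular :: "nat \<Rightarrow> ('v, 'e) multigraph \<Rightarrow> bool" where
  "regular r G \<longleftrightarrow> (\<forall>v\<in>verts G. degree G v = r)"

definition G_mult :: "nat \<Rightarrow> nat \<Rightarrow> ('v, 'e) multigraph set" where
  "G_mult m r = {G. loopless_multigraph G \<and> card (verts G) = m \<and> regular r G}"

definition is_match :: "('v, 'e) multigraph \<Rightarrow> 'e set \<Rightarrow> bool" where
  "is_match G M \<longleftrightarrow> M \<subseteq> edges G \<and> pairwise (\<lambda>e f. ends G e \<inter> ends G f = {}) M"

definition is_k_match :: "nat \<Rightarrow> ('v, 'e) multigraph \<Rightarrow> 'e set \<Rightarrow> bool" where
  "is_k_match k G M \<longleftrightarrow> is_match G M \<and> card M = k"

definition phi :: "nat \<Rightarrow> ('v, 'e) multigraph \<Rightarrow> nat" where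
  "phi k G = card {M. is_k_match k G M}"

definition max_match_size :: "('v, 'e) multigraph \<Rightarrow> nat" where
  "max_match_size G = Max (card ` {M. is_match G M})"

text \<open>
  Every finite multigraph is isomorphic to one whose vertices and edges are natural numbers, so the
  minimum is taken over these. On \<^typ>\<open>nat\<close>, \<open>Inf\<close> of a nonempty set is its least element, and
  \<open>Inf {} = 0\<close>; hence \<open>theta k n r > 0\<close> can only hold when the minimum exists.
\<close>

definition theta :: "nat \<Rightarrow> nat \<Rightarrow> nat \<Rightarrow> nat" where
  "theta k n r = Inf (phi k ` (G_mult (2 * n) r :: (nat, nat) multigraph set))"

definition is_disjoint_union ::
    "('v, 'e) multigraph \<Rightarrow> 'i set \<Rightarrow> ('i \<Rightarrow> ('v, 'e) multigraph) \<Rightarrow> bool" where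
  "is_disjoint_union G I H \<longleftrightarrow>
     (\<forall>i\<in>I. \<forall>j\<in>I. i \<noteq> j \<longrightarrow>
        verts (H i) \<inter> verts (H j) = {} \<and> edges (H i) \<inter> edges (H j) = {}) \<and>
     verts G = (\<Union>i\<in>I. verts (H i)) \<and>
     edges G = (\<Union>i\<in>I. edges (H i)) \<and>
     (\<forall>i\<in>I. \<forall>e\<in>edges (H i). ends G e = ends (H i) e)"

end

theory Submission
  imports Defs
begin

text \<open>
  Regularity gives Hall's condition for the neighbourhoods of the vertices, so there is a permutation
  \<open>s\<close> of the vertices moving every vertex to a neighbour. Let \<open>S\<close> be a maximal set of vertices that is
  disjoint from its image under \<open>s\<close>. The edges joining \<open>v\<close> to \<open>s v\<close> for \<open>v\<close> in \<open>S\<close> form a match, and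
  by maximality every vertex lies in \<open>S\<close>, in the image of \<open>S\<close> or in the preimage of \<open>S\<close>; hence the
  match has at least a third as many edges as there are vertices. For a disjoint union of graphs on
  three vertices, each part carries at most one edge of a match.
\<close>

section \<open>Hall's marriage theorem\<close>

definition hall_condition :: "'i set \<Rightarrow> ('i \<Rightarrow> 'a set) \<Rightarrow> bool" where
  "hall_condition I A \<longleftrightarrow> (\<forall>J\<subseteq>I. card J \<le> card (\<Union>i\<in>J. A i))"

text \<open>
  Rado's argument: if both removals violate the condition, say on \<open>K\<close> and \<open>L\<close> together with \<open>i0\<close>, then
  counting the union and the intersection of the two covered sets gives
  \<open>card (K \<union> L) + 1 + card (K \<inter> L) \<le> card K + card L\<close>.
\<close>

lemma hall_condition_remove_point:
  assumes "finite I" "\<And>i. i \<in> I \<Longrightarrow> finite (A i)" "hall_condition I A"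
    and "i0 \<in> I" "x \<noteq> y"
  shows "hall_condition I (A(i0 := A i0 - {x})) \<or> hall_condition I (A(i0 := A i0 - {y}))"
proof (rule ccontr)
  have violating: "\<exists>K\<subseteq>I - {i0}. card ((\<Union>i\<in>K. A i) \<union> (A i0 - {z})) \<le> card K"
    if viol: "\<not> hall_condition I (A(i0 := A i0 - {z}))" for z
  proof -
    obtain J where J: "J \<subseteq> I" "card (\<Union>i\<in>J. (A(i0 := A i0 - {z})) i) < card J"
      using viol by (auto simp: hall_condition_def not_le)
    \<comment> \<open>Away from \<open>i0\<close> the family is unchanged, so a violating
      \<open>J\<close> without \<open>i0\<close> would already violate the condition for
      \<open>A\<close>.\<close>
    have "i0 \<in> J"
    proof (rule ccontr)
      assume "i0 \<notin> J"
      then have "(\<Union>i\<in>J. (A(i0 := A i0 - {z})) i) = (\<Union>i\<in>J. A i)"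
        by (intro SUP_cong) auto
      then show False
        using J assms(3) by (auto simp: hall_condition_def not_le[symmetric])
    qed
    moreover have "finite J"
      using J(1) assms(1) finite_subset by blast
    moreover have "(\<Union>i\<in>J. (A(i0 := A i0 - {z})) i) = (\<Union>i\<in>J - {i0}. A i) \<union> (A i0 - {z})"
      using \<open>i0 \<in> J\<close> by (auto split: if_splits)
    ultimately have "card ((\<Union>i\<in>J - {i0}. A i) \<union> (A i0 - {z})) \<le> card (J - {i0})"
      using J(2) by simp
    then show ?thesis
      using J(1) by (intro exI[of _ "J - {i0}"] conjI Diff_mono) auto
  qed
  assume "\<not> ?thesis"
  then obtain K L where
    K: "K \<subseteq> I - {i0}" "card ((\<Union>i\<in>K. A i) \<union> (A i0 - {x})) \<le> card K" and
    L: "L \<subseteq> I - {i0}" "card ((\<Union>i\<in>L. A i) \<union> (A i0 - {y})) \<le> card L"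
    using violating by meson
  let ?P = "(\<Union>i\<in>K. A i) \<union> (A i0 - {x})" and ?Q = "(\<Union>i\<in>L. A i) \<union> (A i0 - {y})"
  have fin: "finite K" "finite L"
    using K(1) L(1) assms(1) by (meson finite_Diff finite_subset)+
  then have fin': "finite ?P" "finite ?Q"
    using K(1) L(1) assms(2,4) by auto
  have "card (insert i0 (K \<union> L)) \<le> card (\<Union>i\<in>insert i0 (K \<union> L). A i)"
    using assms(4) K(1) L(1)
    by (intro assms(3)[unfolded hall_condition_def, rule_format]) auto
  \<comment> \<open>As \<open>x\<close> and \<open>y\<close> differ, the two punctured copies of
    \<open>A i0\<close> together recover all of \<open>A i0\<close>.\<close>
  also have "(\<Union>i\<in>insert i0 (K \<union> L). A i) = ?P \<union> ?Q"
    using assms(5) by auto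
  finally have un: "Suc (card (K \<union> L)) \<le> card (?P \<union> ?Q)"
    using fin K(1) L(1) by (subst (asm) card_insert_disjoint) auto
  have "card (K \<inter> L) \<le> card (\<Union>i\<in>K \<inter> L. A i)"
    using K(1) by (intro assms(3)[unfolded hall_condition_def, rule_format]) auto
  also have "\<dots> \<le> card (?P \<inter> ?Q)"
    using fin' by (intro card_mono) auto
  finally have "card (K \<inter> L) \<le> card (?P \<inter> ?Q)" .
  then show False
    using un K(2) L(2) card_Un_Int[OF fin] card_Un_Int[OF fin'] by linarith
qed

text \<open>Induction on the total size of the sets: as long as some set has two points, one of them
  can be removed without losing the condition. Once no set has two points, the condition on single
  indices makes every set a singleton, and on pairs of indices it makes these singletons
  distinct.\<close>

theorem hall:
  assumes "finite I" "\<And>i. i \<in> I \<Longrightarrow> finite (A i)" "hall_condition I A"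
  shows "\<exists>f. inj_on f I \<and> (\<forall>i\<in>I. f i \<in> A i)"
  using assms(2,3)
proof (induction "\<Sum>i\<in>I. card (A i)" arbitrary: A rule: less_induct)
  case less
  show ?case
  proof (cases "\<exists>i\<in>I. \<exists>x\<in>A i. \<exists>y\<in>A i. x \<noteq> y")
    case True
    then obtain i0 x y where i0: "i0 \<in> I" "x \<in> A i0" "y \<in> A i0" "x \<noteq> y"
      by blast
    then obtain z where z: "z \<in> A i0" "hall_condition I (A(i0 := A i0 - {z}))"
      using hall_condition_remove_point[OF assms(1) less.prems(1) less.prems(2)] by metis
    let ?B = "A(i0 := A i0 - {z})"
    have "(\<Sum>i\<in>I. card (?B i)) < (\<Sum>i\<in>I. card (A i))"
    proof (rule sum_strict_mono_ex1)
      show "\<forall>i\<in>I. card (?B i) \<le> card (A i)"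
        by (auto simp: card_Diff1_le)
      show "\<exists>i\<in>I. card (?B i) < card (A i)"
        using i0(1) z(1) less.prems(1) card_Diff1_less by fastforce
    qed (rule assms(1))
    then obtain f where "inj_on f I" "\<forall>i\<in>I. f i \<in> ?B i"
      using less.hyps[of ?B] less.prems(1) z(2) by (metis finite_Diff fun_upd_apply)
    then show ?thesis
      by (metis DiffD1 fun_upd_apply)
  next
    case False
    have "A i \<noteq> {}" if "i \<in> I" for i
      using less.prems(2) that unfolding hall_condition_def by (auto dest!: spec[of _ "{i}"])
    then have "\<forall>i\<in>I. \<exists>a. a \<in> A i"
      by blast
    then obtain f where f: "\<And>i. i \<in> I \<Longrightarrow> f i \<in> A i"
      by metis
    then have A: "A i = {f i}" if "i \<in> I" for i
      using False that by blast
    have "inj_on f I"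
    proof (rule inj_onI, rule ccontr)
      fix i j
      assume ij: "i \<in> I" "j \<in> I" "f i = f j" "i \<noteq> j"
      then have "card {i, j} \<le> card (\<Union>k\<in>{i, j}. A k)"
        using less.prems(2)[unfolded hall_condition_def, rule_format, of "{i, j}"] by simp
      then show False
        using ij A by simp
    qed
    then show ?thesis
      using f by blast
  qed
qed

section \<open>Hall's condition for neighbourhoods\<close>

definition neighbours :: "('v, 'e) multigraph \<Rightarrow> 'v \<Rightarrow> 'v set" where
  "neighbours G v = {w. \<exists>e\<in>edges G. ends G e = {v, w} \<and> v \<noteq> w}"

lemma neighbours_subset:
  "loopless_multigraph G \<Longrightarrow> neighbours G v \<subseteq> verts G"
  by (fastforce simp: neighbours_def loopless_multigraph_def)

text \<open>Double counting: exactly \<open>r * card X\<close> incidences sit at \<open>X\<close>,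
  and moving each to the other end of its edge injects them into the \<open>r * card ?N\<close>
  incidences at the neighbours. Cancelling the positive \<open>r\<close> gives the claim.\<close>

lemma hall_condition_neighbours:
  assumes G: "loopless_multigraph G" and reg: "regular r G" and r: "r \<ge> 1"
  shows "hall_condition (verts G) (neighbours G)"
  unfolding hall_condition_def
proof (intro allI impI)
  fix X
  assume X: "X \<subseteq> verts G"
  let ?N = "\<Union>v\<in>X. neighbours G v"
  define inc where "inc Y = (SIGMA v:Y. {e \<in> edges G. v \<in> ends G e})" for Y
  have fin: "finite (verts G)" "finite (edges G)"
    using G by (auto simp: loopless_multigraph_def)
  have card_inc: "card (inc Y) = r * card Y" if "Y \<subseteq> verts G" for Y
  proof -
    have "card (inc Y) = (\<Sum>v\<in>Y. degree G v)"
      unfolding inc_def degree_def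
      by (rule card_SigmaI) (use that fin finite_subset in auto)
    also have "\<dots> = (\<Sum>v\<in>Y. r)"
      using that reg by (intro sum.cong) (auto simp: regular_def)
    finally show ?thesis
      by simp
  qed
  have N: "?N \<subseteq> verts G"
    using neighbours_subset[OF G] by blast
  \<comment> \<open>The edge is kept as second component: this makes \<open>flip\<close> injective
    even when there are parallel edges, since an edge and one of its ends determine the other
    end.\<close>
  define flip where "flip = (\<lambda>(v, e). (THE w. ends G e = {v, w} \<and> v \<noteq> w, e))"
  have flip: "\<exists>w. ends G e = {v, w} \<and> v \<noteq> w \<and> flip (v, e) = (w, e)"
    if ve: "e \<in> edges G" "v \<in> ends G e" for v e
  proof -
    have "card (ends G e) = 2"
      using G ve(1) by (simp add: loopless_multigraph_def)
    then obtain a b where "ends G e = {a, b}" "a \<noteq> b"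
      by (auto simp: card_2_iff)
    then obtain w where w: "ends G e = {v, w}" "v \<noteq> w"
      using ve(2) that[of a] that[of b] by (auto simp: insert_commute)
    then have "(THE w. ends G e = {v, w} \<and> v \<noteq> w) = w"
      by (intro the_equality) (auto simp: doubleton_eq_iff)
    then show ?thesis
      using w by (auto simp: flip_def)
  qed
  have "inj_on flip (inc X)"
  proof (rule inj_onI)
    fix p p'
    assume p: "p \<in> inc X" "p' \<in> inc X" "flip p = flip p'"
    obtain v e v' e' where ve: "p = (v, e)" "p' = (v', e')"
      by fastforce
    then have "e \<in> edges G" "v \<in> ends G e" "e' \<in> edges G" "v' \<in> ends G e'"
      using p(1,2) by (auto simp: inc_def)
    then obtain w w' where "ends G e = {v, w}" "flip (v, e) = (w, e)"
      "ends G e' = {v', w'}" "flip (v', e') = (w', e')"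
      by (meson flip)
    then show "p = p'"
      using p(3) ve by (auto simp: doubleton_eq_iff)
  qed
  moreover have "flip ` inc X \<subseteq> inc ?N"
  proof (rule image_subsetI)
    fix p
    assume "p \<in> inc X"
    then obtain v e where "p = (v, e)" "v \<in> X" "e \<in> edges G" "v \<in> ends G e"
      by (auto simp: inc_def)
    moreover obtain w where "ends G e = {v, w}" "v \<noteq> w" "flip (v, e) = (w, e)"
      using flip[of e v] calculation by blast
    ultimately have "w \<in> ?N" "flip p = (w, e)" "e \<in> edges G" "w \<in> ends G e"
      unfolding neighbours_def by auto
    then show "flip p \<in> inc ?N"
      by (simp add: inc_def)
  qed
  moreover have "finite (inc ?N)"
    unfolding inc_def using fin N finite_subset by (intro finite_SigmaI) auto
  ultimately have "card (inc X) \<le> card (inc ?N)"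
    using card_inj_on_le by blast
  then show "card X \<le> card ?N"
    using r by (simp add: card_inc X N)
qed

section \<open>From a permutation to a large match\<close>

text \<open>The factor 3 cannot be improved: from a 3-cycle of \<open>s\<close> at most one point
  can be chosen.\<close>

lemma permutation_separated_subset:
  assumes V: "finite V" and s: "inj_on s V" "s ` V \<subseteq> V" "\<And>v. v \<in> V \<Longrightarrow> s v \<noteq> v"
  shows "\<exists>S\<subseteq>V. s ` S \<inter> S = {} \<and> card V \<le> 3 * card S"
proof -
  define F where "F = {S. S \<subseteq> V \<and> s ` S \<inter> S = {}}"
  have "finite F" "{} \<in> F"
    using V by (auto simp: F_def)
  then obtain S where "S \<in> F" "\<forall>T\<in>F. S \<subseteq> T \<longrightarrow> S = T"
    using finite_has_maximal[of F] by blast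
  then have S: "S \<subseteq> V" "s ` S \<inter> S = {}"
    and max: "\<And>T. T \<subseteq> V \<Longrightarrow> s ` T \<inter> T = {} \<Longrightarrow> S \<subseteq> T \<Longrightarrow> S = T"
    by (auto simp: F_def)
  let ?R = "{v \<in> V. s v \<in> S}"
  have fin: "finite S" "finite ?R"
    using S V finite_subset by auto
  have cover: "V \<subseteq> S \<union> s ` S \<union> ?R"
  proof
    fix v
    assume v: "v \<in> V"
    show "v \<in> S \<union> s ` S \<union> ?R"
    proof (rule ccontr)
      assume out: "v \<notin> S \<union> s ` S \<union> ?R"
      then have "s ` insert v S \<inter> insert v S = {}"
        using v S s(3)[OF v] by auto
      then show False
        using max[of "insert v S"] v S(1) out by blast
    qed
  qed
  have "card ?R \<le> card S"
    using fin(1) s(1) by (intro card_inj_on_le[of s]) (auto simp: inj_on_def)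
  moreover have "card V \<le> card (S \<union> s ` S \<union> ?R)"
    using cover fin by (intro card_mono) auto
  moreover have "card (S \<union> s ` S \<union> ?R) \<le> card S + card (s ` S) + card ?R"
    by (meson add_le_mono1 card_Un_le le_trans)
  moreover have "card (s ` S) \<le> card S"
    using fin(1) by (rule card_image_le)
  ultimately have "card V \<le> 3 * card S"
    by linarith
  then show ?thesis
    using S by blast
qed

lemma regular_has_large_match:
  assumes G: "loopless_multigraph G" and reg: "regular r G" and r: "r \<ge> 1"
  shows "\<exists>M. is_match G M \<and> card (verts G) \<le> 3 * card M"
proof -
  have fin: "finite (verts G)"
    using G by (simp add: loopless_multigraph_def)
  moreover have "finite (neighbours G v)" for v
    using neighbours_subset[OF G] fin finite_subset by blast
  ultimately obtain s where s: "inj_on s (verts G)" "\<And>v. v \<in> verts G \<Longrightarrow> s v \<in> neighbours G v"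
    using hall[OF _ _ hall_condition_neighbours[OF G reg r]] by metis
  have "s ` verts G \<subseteq> verts G"
    using s(2) neighbours_subset[OF G] by blast
  moreover have "s v \<noteq> v" if "v \<in> verts G" for v
    using s(2)[OF that] by (auto simp: neighbours_def)
  ultimately obtain S where S: "S \<subseteq> verts G" "s ` S \<inter> S = {}" "card (verts G) \<le> 3 * card S"
    using permutation_separated_subset[OF fin s(1)] by blast
  have "\<forall>v\<in>S. \<exists>e\<in>edges G. ends G e = {v, s v}"
    using s(2) S(1) by (fastforce simp: neighbours_def)
  then obtain h where h: "\<And>v. v \<in> S \<Longrightarrow> h v \<in> edges G \<and> ends G (h v) = {v, s v}"
    by metis
  \<comment> \<open>Injectivity of \<open>s\<close> separates \<open>s v\<close> from
    \<open>s w\<close>; a coincidence of \<open>v\<close> with \<open>s w\<close>, or of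
    \<open>w\<close> with \<open>s v\<close>, would put a point into both \<open>S\<close> and its
    image.\<close>
  have disj: "ends G (h v) \<inter> ends G (h w) = {}" if "v \<in> S" "w \<in> S" "v \<noteq> w" for v w
    using that h S(2) inj_onD[OF inj_on_subset[OF s(1) S(1)]] by auto
  have "is_match G (h ` S)"
    using h disj by (force simp: is_match_def pairwise_def)
  moreover have "inj_on h S"
  proof (rule inj_onI, rule ccontr)
    fix v w
    assume vw: "v \<in> S" "w \<in> S" "h v = h w" "v \<noteq> w"
    then show False
      using disj[of v w] h[of v] by simp
  qed
  ultimately show ?thesis
    using S(3) by (metis card_image)
qed

section \<open>Matches of prescribed size\<close>

lemma is_match_subset:
  "is_match G M \<Longrightarrow> M' \<subseteq> M \<Longrightarrow> is_match G M'"
  unfolding is_match_def using pairwise_subset by blast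

lemma regular_has_k_match:
  assumes G: "G \<in> G_mult n r" and r: "r \<ge> 1" and k: "k \<le> nat \<lceil>real n / 3\<rceil>"
  shows "\<exists>M. is_k_match k G M"
proof -
  obtain M where M: "is_match G M" "n \<le> 3 * card M"
    using G r regular_has_large_match by (auto simp: G_mult_def)
  \<comment> \<open>Since \<open>card M\<close> is an integer, \<open>n \<le> 3 * card M\<close>
    bounds the rounded-up quotient as well.\<close>
  have "k \<le> card M"
    using k M(2) by linarith
  then obtain M' where "M' \<subseteq> M" "card M' = k"
    by (meson obtain_subset_with_card_n)
  then show ?thesis
    using M(1) is_match_subset unfolding is_k_match_def by blast
qed

lemma finite_matches:
  "loopless_multigraph G \<Longrightarrow> finite {M. is_match G M}"
  by (rule finite_subset[of _ "Pow (edges G)"])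
    (auto simp: is_match_def loopless_multigraph_def)

lemma phi_pos:
  assumes "loopless_multigraph G" "is_k_match k G M"
  shows "phi k G > 0"
proof -
  \<comment> \<open>An infinite set would have \<open>card\<close> equal to 0, so a member alone
    does not make \<open>phi\<close> positive.\<close>
  have "finite {M. is_k_match k G M}"
    by (rule finite_subset[OF _ finite_matches[OF assms(1)]]) (auto simp: is_k_match_def)
  then show ?thesis
    using assms(2) by (auto simp: phi_def card_gt_0_iff)
qed

section \<open>Upper bound for unions of triples\<close>

text \<open>Sending an edge of the match to the part containing it is injective: two disjoint edges
  in one part would occupy four of its three vertices.\<close>

lemma match_card_le_triples:
  assumes union: "is_disjoint_union G {..<q} H"
    and H: "\<And>i. i < q \<Longrightarrow> H i \<in> G_mult 3 r"
    and M: "is_match G M"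
  shows "card M \<le> q"
proof -
  have "M \<subseteq> (\<Union>i<q. edges (H i))"
    using union M unfolding is_disjoint_union_def is_match_def by metis
  then have "\<forall>e\<in>M. \<exists>i<q. e \<in> edges (H i)"
    by blast
  then obtain part where part: "\<And>e. e \<in> M \<Longrightarrow> part e < q \<and> e \<in> edges (H (part e))"
    by metis
  have "inj_on part M"
  proof (rule inj_onI, rule ccontr)
    fix e f
    assume ef: "e \<in> M" "f \<in> M" "part e = part f" "e \<noteq> f"
    define i where "i = part e"
    have i: "i < q" "e \<in> edges (H i)" "f \<in> edges (H i)"
      using part[OF ef(1)] part[OF ef(2)] ef(3) by (auto simp: i_def)
    have Hi: "finite (verts (H i))" "card (verts (H i)) = 3"
      and in_H: "\<And>g. g \<in> edges (H i) \<Longrightarrow> ends (H i) g \<subseteq> verts (H i) \<and> card (ends (H i) g) = 2"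
      using H[OF i(1)] by (auto simp: G_mult_def loopless_multigraph_def)
    have "ends G e = ends (H i) e" "ends G f = ends (H i) f"
      using union i by (auto simp: is_disjoint_union_def)
    moreover have "ends G e \<inter> ends G f = {}"
      using M ef(1,2,4) unfolding is_match_def pairwise_def by metis
    ultimately have disj: "ends (H i) e \<inter> ends (H i) f = {}"
      by simp
    have "card (ends (H i) e \<union> ends (H i) f) = 4"
      using disj in_H[OF i(2)] in_H[OF i(3)] Hi(1) finite_subset by (subst card_Un_disjoint) auto
    moreover have "card (ends (H i) e \<union> ends (H i) f) \<le> card (verts (H i))"
      using in_H[OF i(2)] in_H[OF i(3)] Hi(1) by (intro card_mono) auto
    ultimately show False
      using Hi(2) by simp
  qed
  then have "card M \<le> card {..<q}"
    using part by (intro card_inj_on_le) auto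
  then show ?thesis
    by simp
qed

section \<open>Positivity of \<open>theta\<close>\<close>

text \<open>Needed because \<open>Inf {} = 0\<close>: without a graph of these parameters
  \<open>theta\<close> would vanish.\<close>

lemma G_mult_even_nonempty:
  "(G_mult (2 * n) r :: (nat, nat) multigraph set) \<noteq> {}"
proof -
  text \<open>\<open>n\<close> disjoint bundles of \<open>r\<close> parallel edges\<close>
  define G :: "(nat, nat) multigraph" where
    "G = \<lparr>verts = {..<2 * n}, edges = {..<n * r}, ends = (\<lambda>e. {2 * (e div r), 2 * (e div r) + 1})\<rparr>"
  have "e div r < n" if "e < n * r" for e
    using that by (rule less_mult_imp_div_less)
  then have "loopless_multigraph G"
    by (fastforce simp: loopless_multigraph_def G_def)
  moreover have "degree G v = r" if v: "v < 2 * n" for v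
  proof -
    have "v \<in> {2 * (e div r), 2 * (e div r) + 1} \<longleftrightarrow> e div r = v div 2" for e
      by auto
    then have "degree G v = card {e. e < n * r \<and> e div r = v div 2}"
      by (simp add: degree_def G_def)
    \<comment> \<open>The edges at \<open>v\<close> form the bundle number \<open>v div 2\<close>, a
      block of \<open>r\<close> consecutive numbers.\<close>
    also have "{e. e < n * r \<and> e div r = v div 2} = {(v div 2) * r..<(v div 2) * r + r}"
    proof (intro equalityI subsetI; clarify?)
      fix e
      assume "e < n * r" "e div r = v div 2"
      moreover from this have "r > 0"
        by (cases r) auto
      ultimately show "e \<in> {(v div 2) * r..<(v div 2) * r + r}"
        using dividend_less_div_times[of r e] div_times_less_eq_dividend[of e r] by auto
    next
      fix e
      assume e: "e \<in> {(v div 2) * r..<(v div 2) * r + r}"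
      then have "e div r = v div 2"
        by (auto intro!: div_nat_eqI simp: mult.commute)
      \<comment> \<open>From \<open>v div 2 < n\<close> the whole block lies below
        \<open>n * r\<close>, so no edge of the bundle is cut off.\<close>
      moreover have "(v div 2) * r + r \<le> n * r"
        using mult_le_mono1[of "Suc (v div 2)" n r] v
        by (simp add: less_mult_imp_div_less mult.commute add.commute)
      then have "e < n * r"
        using e unfolding atLeastLessThan_iff by (meson less_le_trans)
      ultimately show "e < n * r \<and> e div r = v div 2"
        by blast
    qed
    finally show ?thesis
      by simp
  qed
  ultimately have "G \<in> G_mult (2 * n) r"
    by (auto simp: G_mult_def regular_def G_def)
  then show ?thesis
    by blast
qed

text \<open>The infimum of a nonempty set of naturals is attained, so it suffices to find a
  \<open>k\<close>-match in one minimising graph; its \<open>2 * n\<close> vertices account for the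
  bound on \<open>k\<close>.\<close>

lemma theta_pos:
  assumes "r \<ge> 1" "k \<le> nat \<lceil>2 * real n / 3\<rceil>"
  shows "theta k n r > 0"
proof -
  have "theta k n r \<in> phi k ` (G_mult (2 * n) r :: (nat, nat) multigraph set)"
    unfolding theta_def by (rule Inf_nat_def1) (simp add: G_mult_even_nonempty)
  then obtain G :: "(nat, nat) multigraph" where G: "G \<in> G_mult (2 * n) r" "theta k n r = phi k G"
    by blast
  then obtain M where "is_k_match k G M"
    using regular_has_k_match[OF G(1)] assms by auto
  then show ?thesis
    using phi_pos G by (auto simp: G_mult_def)
qed

lemma max_match_size_triples:
  assumes G: "G \<in> G_mult (3 * q) r" and r: "r \<ge> 1"
    and H: "\<And>i. i < q \<Longrightarrow> H i \<in> G_mult 3 r"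
    and union: "is_disjoint_union G {..<q} H"
  shows "max_match_size G = q"
proof -
  obtain M where "is_k_match q G M"
    using regular_has_k_match[OF G r, of q] by auto
  then have "q \<in> card ` {M. is_match G M}"
    by (auto simp: is_k_match_def)
  moreover have "finite {M. is_match G M}"
    using G finite_matches by (auto simp: G_mult_def)
  ultimately show ?thesis
    unfolding max_match_size_def
    using match_card_le_triples[OF union H] by (intro Max_eqI) auto
qed

theorem theorem6p3:
  shows "(\<forall>(r::nat) (n::nat) (G :: ('v, 'e) multigraph).
            r \<ge> 1 \<and> n \<ge> 1 \<and> G \<in> G_mult n r \<longrightarrow>
              (\<exists>M. is_k_match (nat \<lceil>real n / 3\<rceil>) G M) \<and>
              (\<forall>(l::nat) (q::nat) (H :: nat \<Rightarrow> ('v, 'e) multigraph).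
                 l \<ge> 1 \<and> q \<ge> 1 \<and> r = 2 * l \<and> n = 3 * q \<and>
                 (\<forall>i<q. H i \<in> G_mult 3 (2 * l)) \<and> is_disjoint_union G {..<q} H \<longrightarrow>
                   max_match_size G = nat \<lceil>real n / 3\<rceil>)) \<and>
         (\<forall>(n::nat) (r::nat) (k::nat).
            n \<ge> 1 \<and> r \<ge> 1 \<and> k \<in> {1..nat \<lceil>2 * real n / 3\<rceil>} \<longrightarrow> theta k n r > 0)"
proof (intro conjI allI impI; (elim conjE)?)
  fix r n :: nat and G :: "('v, 'e) multigraph"
  assume "r \<ge> 1" "G \<in> G_mult n r"
  then show "\<exists>M. is_k_match (nat \<lceil>real n / 3\<rceil>) G M"
    using regular_has_k_match by blast
next
  fix r n l q :: nat and G :: "('v, 'e) multigraph" and H :: "nat \<Rightarrow> ('v, 'e) multigraph"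
  assume "r \<ge> 1" "G \<in> G_mult n r" "r = 2 * l" "n = 3 * q"
    "\<forall>i<q. H i \<in> G_mult 3 (2 * l)" "is_disjoint_union G {..<q} H"
  then show "max_match_size G = nat \<lceil>real n / 3\<rceil>"
    using max_match_size_triples[of G q r H] by simp
next
  fix n r k :: nat
  assume "r \<ge> 1" "k \<in> {1..nat \<lceil>2 * real n / 3\<rceil>}"
  then show "theta k n r > 0"
    by (intro theta_pos) auto
qed

end
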